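(* Let $(X,d)$ be a metric space which admits a consistent convex geodesic bicombing $\sigma : X\times X\times[0,1]\to X$. Then $$\Sigma(A,B,t) = \overline{\mathrm{co}}\bigg(\bigcup_{a\in A}\bigcup_{b\in B}\{\sigma(a,b,t)\}\bigg), \qquad A,B\in CB(X),\ t\in[0,1],$$ defines a conical geodesic bicombing on the metric space $(CB(X),d_H)$.
   Context: Bicombings. A geodesic bicombing on a metric space $(Y,\rho)$ is a function $\sigma:Y\times Y\times[0,1]\to Y$ such that for all $x,y\in Y$ and $s,t\in[0,1]$: $\sigma(x,y,0)=x$, $\sigma(x,y,1)=y$, and $\rho(\sigma(x,y,s),\sigma(x,y,t))=|t-s|\rho(x,y)$. It is conical if $\rho(\sigma(a,b,t),\sigma(c,d,t))\le(1-t)\rho(a,c)+t\rho(b,d)$ for all $a,b,c,d\in Y$, $t\in[0,1]$. It is convex if for all $a,b,c,d\in Y$ the map $t\mapsto\rho(\sigma(a,b,t),\sigma(c,d,t))$ is convex on $[0,1]$. It is consistent if $\sigma(\sigma(x,y,r),\sigma(x,y,s),t)=\sigma(x,y,(1-t)r+ts)$ for all $x,y\in Y$ and $r,s,t\in[0,1]$ with $r<s$. Convexity. Given the geodesic bicombing $\sigma$ on $X$, a set $C\subseteq X$ is convex if $\sigma(x,y,t)\in C$ for all $x,y\in C$, $t\in[0,1]$. The closed convex hull $\overline{\mathrm{co}}(A)$ of $A\subseteq X$ is the intersection of all closed convex sets containing $A$. Hyperspace. $CB(X)$ is the set of nonempty, closed, bounded, convex subsets of $X$, equipped with the Hausdorff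 metric $d_H(A,B)=\inf\{\varepsilon>0: A\subseteq N_\varepsilon(B)\text{ and }B\subseteq N_\varepsilon(A)\}$, where $N_\varepsilon(A)=\{x\in X: d(x,A)\le\varepsilon\}$ and $d(x,A)=\inf_{a\in A}d(x,a)$. *)

theory Defs
  imports "HOL-Analysis.Analysis"
begin

context Metric_space
begin

definition point_set_dist :: "'a \<Rightarrow> 'a set \<Rightarrow> real"
  where "point_set_dist x A = (INF a\<in>A. d x a)"

definition closed_nbhd :: "real \<Rightarrow> 'a set \<Rightarrow> 'a set"
  where "closed_nbhd \<epsilon> A = {x \<in> M. point_set_dist x A \<le> \<epsilon>}"

text \<open>The set of admissible \<open>\<epsilon>\<close> is nonempty whenever \<open>A\<close> and \<open>B\<close> are nonempty and bounded.
  The value 0 in the other case is a totality convention: \<open>Inf {}\<close> is unspecified on the reals,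
  but the locale \<^locale>\<open>Metric_space\<close> demands nonnegativity also off the carrier.\<close>

definition hausdorff_dist :: "'a set \<Rightarrow> 'a set \<Rightarrow> real"
  where "hausdorff_dist A B =
    (let E = {\<epsilon>. \<epsilon> > 0 \<and> A \<subseteq> closed_nbhd \<epsilon> B \<and> B \<subseteq> closed_nbhd \<epsilon> A}
     in if E = {} then 0 else Inf E)"

end

text \<open>A bicombing is curried here, and only its values on \<open>M \<times> M \<times> [0,1]\<close> are constrained.\<close>

locale geodesic_bicombing = Metric_space M d
  for M :: "'a set" and d :: "'a \<Rightarrow> 'a \<Rightarrow> real" +
  fixes \<sigma> :: "'a \<Rightarrow> 'a \<Rightarrow> real \<Rightarrow> 'a"
  assumes maps_to: "\<lbrakk>x \<in> M; y \<in> M; t \<in> {0..1}\<rbrakk> \<Longrightarrow> \<sigma> x y t \<in> M"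
    and start: "\<lbrakk>x \<in> M; y \<in> M\<rbrakk> \<Longrightarrow> \<sigma> x y 0 = x"
    and finish: "\<lbrakk>x \<in> M; y \<in> M\<rbrakk> \<Longrightarrow> \<sigma> x y 1 = y"
    and geodesic: "\<lbrakk>x \<in> M; y \<in> M; s \<in> {0..1}; t \<in> {0..1}\<rbrakk>
      \<Longrightarrow> d (\<sigma> x y s) (\<sigma> x y t) = \<bar>t - s\<bar> * d x y"
begin

definition bicombing_convex :: "'a set \<Rightarrow> bool"
  where "bicombing_convex C \<longleftrightarrow>
    C \<subseteq> M \<and> (\<forall>x\<in>C. \<forall>y\<in>C. \<forall>t\<in>{0..1}. \<sigma> x y t \<in> C)"

text \<open>Meaningful for \<open>A \<subseteq> M\<close>: then \<open>M\<close> itself belongs to the intersected family.\<close>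

definition closed_convex_hull :: "'a set \<Rightarrow> 'a set"
  where "closed_convex_hull A =
    \<Inter> {C. closedin mtopology C \<and> bicombing_convex C \<and> A \<subseteq> C}"

definition CB :: "'a set set"
  where "CB = {C. C \<noteq> {} \<and> closedin mtopology C \<and> mbounded C \<and> bicombing_convex C}"

end

locale conical_geodesic_bicombing = geodesic_bicombing +
  assumes conical: "\<lbrakk>a \<in> M; b \<in> M; a' \<in> M; b' \<in> M; t \<in> {0..1}\<rbrakk>
      \<Longrightarrow> d (\<sigma> a b t) (\<sigma> a' b' t) \<le> (1 - t) * d a a' + t * d b b'"

locale convex_geodesic_bicombing = geodesic_bicombing +
  assumes convex: "\<lbrakk>a \<in> M; b \<in> M; a' \<in> M; b' \<in> M\<rbrakk>
      \<Longrightarrow> convex_on {0..1} (\<lambda>t. d (\<sigma> a b t) (\<sigma> a' b' t))"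

locale consistent_geodesic_bicombing = geodesic_bicombing +
  assumes consistent:
    "\<lbrakk>x \<in> M; y \<in> M; r \<in> {0..1}; s \<in> {0..1}; t \<in> {0..1}; r < s\<rbrakk>
      \<Longrightarrow> \<sigma> (\<sigma> x y r) (\<sigma> x y s) t = \<sigma> x y ((1 - t) * r + t * s)"

end

theory Submission
  imports Defs
begin

text \<open>
  Write \<open>\<Sigma>\<^sub>t\<close> for \<open>\<Sigma>(A,B,t)\<close> and \<open>D\<close> for the Hausdorff distance of \<open>A\<close> and \<open>B\<close>. A convex bicombing is
  conical, because a convex function on \<open>[0,1]\<close> lies below its chord. Conicality makes closed balls
  and closed neighbourhoods of convex sets convex. So a closed convex hull stays inside any
  closed neighbourhood of a convex set that contains its generators, and every Hausdorff estimate
  for \<open>\<Sigma>\<close> needs to be checked only on points \<open>\<sigma>(a,b,t)\<close>. For the conical inequality this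
  is immediate: move \<open>a\<close> and \<open>b\<close> to nearby points of the other two sets.

  The geodesic identity is where consistency enters. Let \<open>s < t\<close>, \<open>x = \<sigma>(a,b,s)\<close> and
  \<open>y = \<sigma>(a,b,t)\<close>. The points \<open>a\<close> and \<open>b\<close> may be much further apart than \<open>D\<close>, so \<open>y\<close> need not
  be close enough to \<open>x\<close>. But \<open>x\<close> lies on the chosen geodesic from \<open>a\<close> to \<open>y\<close>, and \<open>a\<close> is at
  distance at most about \<open>t D\<close> from the point \<open>a' = \<sigma>(a,b',t)\<close> of \<open>\<Sigma>\<^sub>t\<close>, where \<open>b'\<close> is a nearly closest point
  of \<open>B\<close> to \<open>a\<close>. Replacing \<open>a\<close> by \<open>a'\<close> moves \<open>x\<close> into the convex set \<open>\<Sigma>\<^sub>t\<close> at a cost of about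
  \<open>(1 - s/t) t D = (t - s) D\<close>. Exchanging the roles of the endpoints handles the other inclusion,
  so the distance of \<open>\<Sigma>\<^sub>s\<close> and \<open>\<Sigma>\<^sub>t\<close> is at most \<open>(t - s) D\<close>. Equality is then forced by the triangle
  inequality along \<open>A = \<Sigma>\<^sub>0, \<Sigma>\<^sub>s, \<Sigma>\<^sub>t, \<Sigma>\<^sub>1 = B\<close>.
\<close>

section \<open>The Hausdorff distance on bounded sets\<close>

context Metric_space
begin

lemma point_set_dist_le_iff:
  assumes "B \<noteq> {}"
  shows "point_set_dist x B \<le> e \<longleftrightarrow> (\<forall>r>e. \<exists>b\<in>B. d x b < r)"
proof -
  have "bdd_below (d x ` B)"
    by (rule bdd_belowI[of _ 0]) auto
  then have less: "point_set_dist x B < r \<longleftrightarrow> (\<exists>b\<in>B. d x b < r)" for r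
    using assms by (simp add: point_set_dist_def cINF_less_iff)
  have "point_set_dist x B \<le> e \<longleftrightarrow> (\<forall>r>e. point_set_dist x B < r)"
    by (meson dense_ge le_less_trans less_imp_le)
  then show ?thesis
    by (simp add: less)
qed

lemma in_closed_nbhd_iff:
  assumes "B \<noteq> {}"
  shows "x \<in> closed_nbhd e B \<longleftrightarrow> x \<in> M \<and> (\<forall>r>e. \<exists>b\<in>B. d x b < r)"
  using assms by (simp add: closed_nbhd_def point_set_dist_le_iff)

lemma closed_nbhd_mono: "e \<le> f \<Longrightarrow> closed_nbhd e B \<subseteq> closed_nbhd f B"
  by (auto simp: closed_nbhd_def)

lemma subset_closed_nbhd_trans:
  assumes "B \<noteq> {}" "C \<noteq> {}" "C \<subseteq> M"
    and AB: "A \<subseteq> closed_nbhd e B" and BC: "B \<subseteq> closed_nbhd f C"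
  shows "A \<subseteq> closed_nbhd (e + f) C"
proof
  fix a assume a: "a \<in> A"
  have "\<exists>c\<in>C. d a c < r" if r: "r > e + f" for r
  proof -
    define \<delta> where "\<delta> = (r - (e + f)) / 2"
    have \<delta>: "\<delta> > 0" "r = (e + \<delta>) + (f + \<delta>)"
      using r by (auto simp: \<delta>_def field_simps)
    obtain b where b: "b \<in> B" "d a b < e + \<delta>"
      using a AB \<delta> assms(1) in_closed_nbhd_iff[of B a e] by (meson less_add_same_cancel1 subsetD)
    obtain c where c: "c \<in> C" "d b c < f + \<delta>"
      using b BC \<delta> assms(2) in_closed_nbhd_iff[of C b f] by (meson less_add_same_cancel1 subsetD)
    have "d a c \<le> d a b + d b c"
      using a b c AB BC assms(3) by (intro triangle) (auto simp: closed_nbhd_def)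
    then show ?thesis
      using b c \<delta> by (intro bexI[of _ c]) auto
  qed
  moreover have "a \<in> M"
    using a AB by (auto simp: closed_nbhd_def)
  ultimately show "a \<in> closed_nbhd (e + f) C"
    using assms(2) by (simp add: in_closed_nbhd_iff)
qed

lemma closedin_closed_nbhd:
  assumes "B \<noteq> {}" "B \<subseteq> M"
  shows "closedin mtopology (closed_nbhd e B)"
  unfolding closedin_metric
proof (intro conjI allI impI)
  show "closed_nbhd e B \<subseteq> M"
    by (auto simp: closed_nbhd_def)
  fix x assume x: "x \<in> M - closed_nbhd e B"
  then obtain r where r: "r > e" "\<And>b. b \<in> B \<Longrightarrow> r \<le> d x b"
    using assms(1) by (auto simp: in_closed_nbhd_iff not_less)
  define \<delta> where "\<delta> = (r - e) / 2"
  have \<delta>: "\<delta> > 0" "r = (e + \<delta>) + \<delta>"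
    using r by (auto simp: \<delta>_def field_simps)
  have "y \<notin> closed_nbhd e B" if y: "y \<in> mball x \<delta>" for y
  proof
    assume "y \<in> closed_nbhd e B"
    then obtain b where b: "b \<in> B" "d y b < e + \<delta>"
      using assms(1) \<delta> by (meson in_closed_nbhd_iff less_add_same_cancel1)
    have "d x b \<le> d x y + d y b"
      using b x y assms(2) by (intro triangle) auto
    then show False
      using b y \<delta> r(2)[of b] by auto
  qed
  then show "\<exists>\<delta>>0. disjnt (closed_nbhd e B) (mball x \<delta>)"
    using \<delta>(1) by (auto simp: disjnt_def)
qed

lemma closed_nbhd_0:
  assumes "B \<noteq> {}" "closedin mtopology B"
  shows "closed_nbhd 0 B = B"
proof
  have BM: "B \<subseteq> M"
    using assms(2) closedin_metric by blast
  show "B \<subseteq> closed_nbhd 0 B"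
  proof
    fix x assume "x \<in> B"
    with BM have "x \<in> M" "d x x = 0" by auto
    with \<open>x \<in> B\<close> show "x \<in> closed_nbhd 0 B"
      unfolding in_closed_nbhd_iff[OF assms(1)] by metis
  qed
  show "closed_nbhd 0 B \<subseteq> B"
  proof
    fix x assume x: "x \<in> closed_nbhd 0 B"
    show "x \<in> B"
    proof (rule ccontr)
      assume "x \<notin> B"
      moreover have xM: "x \<in> M"
        using x by (simp add: closed_nbhd_def)
      ultimately obtain r where r: "r > 0" "disjnt B (mball x r)"
        using assms(2) unfolding closedin_metric by blast
      obtain b where "b \<in> B" "d x b < r"
        using x r assms(1) by (auto simp: in_closed_nbhd_iff)
      then show False
        using r(2) BM xM by (auto simp: disjnt_iff)
    qed
  qed
qed

lemma hausdorff_dist_commute: "hausdorff_dist A B = hausdorff_dist B A"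
  by (simp add: hausdorff_dist_def conj_commute)

lemma hausdorff_dist_nonneg: "0 \<le> hausdorff_dist A B"
  by (auto simp: hausdorff_dist_def Let_def intro!: cInf_greatest)

lemma mbounded_subset_closed_nbhd:
  assumes "mbounded A" "mbounded B" "B \<noteq> {}"
  obtains e where "e > 0" "A \<subseteq> closed_nbhd e B"
proof -
  have "mbounded (A \<union> B)"
    using assms by (simp add: mbounded_Un)
  then obtain e where e: "e > 0" "\<And>x y. x \<in> A \<union> B \<Longrightarrow> y \<in> A \<union> B \<Longrightarrow> d x y \<le> e" and "A \<union> B \<subseteq> M"
    by (auto simp: mbounded_alt_pos)
  have "A \<subseteq> closed_nbhd e B"
  proof
    fix a assume "a \<in> A"
    moreover obtain b where "b \<in> B"
      using assms(3) by blast
    ultimately have "d a b \<le> e" "a \<in> M"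
      using e \<open>A \<union> B \<subseteq> M\<close> by auto
    then show "a \<in> closed_nbhd e B"
      using \<open>b \<in> B\<close> by (auto simp: in_closed_nbhd_iff[OF assms(3)] intro!: bexI[of _ b])
  qed
  with e(1) that show thesis by blast
qed

text \<open>The infimum defining the Hausdorff distance is attained, since membership in a closed
  neighbourhood only constrains distances up to arbitrarily small errors. Hence the distance can
  be handled through inclusions alone.\<close>

lemma hausdorff_dist_le_iff:
  assumes "A \<noteq> {}" "mbounded A" "B \<noteq> {}" "mbounded B" "0 \<le> e"
  shows "hausdorff_dist A B \<le> e \<longleftrightarrow> A \<subseteq> closed_nbhd e B \<and> B \<subseteq> closed_nbhd e A"
proof -
  define E where "E = {e. e > 0 \<and> A \<subseteq> closed_nbhd e B \<and> B \<subseteq> closed_nbhd e A}"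
  obtain e1 where e1: "e1 > 0" "A \<subseteq> closed_nbhd e1 B"
    using mbounded_subset_closed_nbhd assms by metis
  obtain e2 where e2: "e2 > 0" "B \<subseteq> closed_nbhd e2 A"
    using mbounded_subset_closed_nbhd assms by metis
  have "max e1 e2 \<in> E"
    using e1 e2 closed_nbhd_mono[of e1 "max e1 e2" B] closed_nbhd_mono[of e2 "max e1 e2" A]
    by (auto simp: E_def)
  then have ne: "E \<noteq> {}" by blast
  have bdd: "bdd_below E"
    by (rule bdd_belowI[of _ 0]) (auto simp: E_def)
  have hd: "hausdorff_dist A B = Inf E"
    using ne by (simp add: hausdorff_dist_def flip: E_def)
  show ?thesis
  proof
    assume le: "hausdorff_dist A B \<le> e"
    have sub: "A \<subseteq> closed_nbhd r B \<and> B \<subseteq> closed_nbhd r A" if "r > e" for r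
    proof -
      have "Inf E < r"
        using that le hd by linarith
      then obtain f where "f \<in> E" "f < r"
        using cInf_less_iff[OF ne bdd] by blast
      then show ?thesis
        using closed_nbhd_mono[of f r A] closed_nbhd_mono[of f r B] by (auto simp: E_def)
    qed
    have "x \<in> closed_nbhd e C" if x: "\<And>r. r > e \<Longrightarrow> x \<in> closed_nbhd r C" for x C
    proof -
      have "point_set_dist x C \<le> e"
        by (rule dense_ge) (use x in \<open>simp add: closed_nbhd_def\<close>)
      moreover have "x \<in> M"
        using x[of "e + 1"] by (simp add: closed_nbhd_def)
      ultimately show ?thesis
        by (simp add: closed_nbhd_def)
    qed
    then show "A \<subseteq> closed_nbhd e B \<and> B \<subseteq> closed_nbhd e A"
      using sub by blast
  next
    assume sub: "A \<subseteq> closed_nbhd e B \<and> B \<subseteq> closed_nbhd e A"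
    have "Inf E \<le> r" if "r > e" for r
    proof -
      have "r \<in> E"
        using sub that assms(5) closed_nbhd_mono[of e r A] closed_nbhd_mono[of e r B]
        by (auto simp: E_def)
      then show ?thesis
        using bdd by (rule cInf_lower)
    qed
    then show "hausdorff_dist A B \<le> e"
      unfolding hd by (rule dense_ge)
  qed
qed

lemma subset_closed_nbhd_hausdorff_dist:
  assumes "A \<noteq> {}" "mbounded A" "B \<noteq> {}" "mbounded B"
  shows "A \<subseteq> closed_nbhd (hausdorff_dist A B) B"
  using hausdorff_dist_le_iff[OF assms hausdorff_dist_nonneg[of A B]] by simp

lemma hausdorff_dist_triangle:
  assumes "A \<noteq> {}" "mbounded A" "B \<noteq> {}" "mbounded B" "C \<noteq> {}" "mbounded C"
  shows "hausdorff_dist A C \<le> hausdorff_dist A B + hausdorff_dist B C"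
proof -
  have sub: "A \<subseteq> M" "C \<subseteq> M"
    using assms mbounded_subset_mspace by auto
  have "A \<subseteq> closed_nbhd (hausdorff_dist A B + hausdorff_dist B C) C"
    by (rule subset_closed_nbhd_trans[of B])
      (use assms sub subset_closed_nbhd_hausdorff_dist in auto)
  moreover have "C \<subseteq> closed_nbhd (hausdorff_dist C B + hausdorff_dist B A) A"
    by (rule subset_closed_nbhd_trans[of B])
      (use assms sub subset_closed_nbhd_hausdorff_dist in auto)
  ultimately show ?thesis
    using assms by (simp add: hausdorff_dist_le_iff hausdorff_dist_nonneg hausdorff_dist_commute
        add.commute)
qed

lemma hausdorff_dist_eq_0_iff:
  assumes "A \<noteq> {}" "mbounded A" "closedin mtopology A"
    and "B \<noteq> {}" "mbounded B" "closedin mtopology B"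
  shows "hausdorff_dist A B = 0 \<longleftrightarrow> A = B"
proof -
  have "hausdorff_dist A B = 0 \<longleftrightarrow> hausdorff_dist A B \<le> 0"
    using hausdorff_dist_nonneg[of A B] by auto
  also have "\<dots> \<longleftrightarrow> A \<subseteq> B \<and> B \<subseteq> A"
    using assms by (simp add: hausdorff_dist_le_iff closed_nbhd_0)
  finally show ?thesis by auto
qed

end

section \<open>Closed convex hulls\<close>

context geodesic_bicombing
begin

lemma CB_D:
  assumes "A \<in> CB"
  shows "A \<noteq> {}" "closedin mtopology A" "mbounded A" "bicombing_convex A" "A \<subseteq> M"
  using assms by (auto simp: CB_def bicombing_convex_def)

lemma CB_near_point:
  assumes "A \<in> CB" "B \<in> CB" "a \<in> A" "hausdorff_dist A B < r"
  obtains b where "b \<in> B" "d a b < r"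
proof -
  have "a \<in> closed_nbhd (hausdorff_dist A B) B"
    using subset_closed_nbhd_hausdorff_dist[of A B] CB_D(1,3)[OF assms(1)] CB_D(1,3)[OF assms(2)]
      assms(3) by auto
  with assms(4) that show thesis
    by (auto simp: in_closed_nbhd_iff[OF CB_D(1)[OF assms(2)]])
qed

lemma metric_space_CB: "Metric_space CB hausdorff_dist"
proof
  show "hausdorff_dist A B = hausdorff_dist B A" for A B
    by (rule hausdorff_dist_commute)
qed (simp_all add: hausdorff_dist_nonneg hausdorff_dist_triangle hausdorff_dist_eq_0_iff CB_D)

lemma closed_convex_hull_superset: "S \<subseteq> closed_convex_hull S"
  by (auto simp: closed_convex_hull_def)

lemma closed_convex_hull_minimal:
  "closedin mtopology C \<Longrightarrow> bicombing_convex C \<Longrightarrow> S \<subseteq> C \<Longrightarrow> closed_convex_hull S \<subseteq> C"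
  by (auto simp: closed_convex_hull_def)

lemma bicombing_convex_M: "bicombing_convex M"
  by (auto simp: bicombing_convex_def maps_to)

lemma closed_convex_hull_closed_convex:
  assumes "S \<subseteq> M"
  shows "closedin mtopology (closed_convex_hull S)" "bicombing_convex (closed_convex_hull S)"
proof -
  define F where "F = {C. closedin mtopology C \<and> bicombing_convex C \<and> S \<subseteq> C}"
  have hull: "closed_convex_hull S = \<Inter>F"
    by (simp add: closed_convex_hull_def F_def)
  have "M \<in> F"
    using assms closedin_topspace[of mtopology] by (simp add: F_def bicombing_convex_M)
  then show "closedin mtopology (closed_convex_hull S)"
    unfolding hull by (intro closedin_Inter) (auto simp: F_def)
  show "bicombing_convex (closed_convex_hull S)"
    using \<open>M \<in> F\<close> unfolding hull by (fastforce simp: bicombing_convex_def F_def)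
qed

lemma closed_convex_hull_eq:
  "closedin mtopology C \<Longrightarrow> bicombing_convex C \<Longrightarrow> closed_convex_hull C = C"
  by (simp add: closed_convex_hull_minimal closed_convex_hull_superset subset_antisym)

lemma bicombing_refl: "\<lbrakk>p \<in> M; t \<in> {0..1}\<rbrakk> \<Longrightarrow> \<sigma> p p t = p"
  using geodesic[of p p 0 t] by (simp add: start maps_to)

definition hull_bicombing :: "'a set \<Rightarrow> 'a set \<Rightarrow> real \<Rightarrow> 'a set"
  where "hull_bicombing A B t = closed_convex_hull (\<Union>a\<in>A. \<Union>b\<in>B. {\<sigma> a b t})"

lemma hull_bicombing_memI: "\<lbrakk>a \<in> A; b \<in> B\<rbrakk> \<Longrightarrow> \<sigma> a b t \<in> hull_bicombing A B t"
  using closed_convex_hull_superset[of "\<Union>a\<in>A. \<Union>b\<in>B. {\<sigma> a b t}"]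
  by (auto simp: hull_bicombing_def)

lemma hull_bicombing_subset:
  assumes "closedin mtopology C" "bicombing_convex C"
    and "\<And>a b. a \<in> A \<Longrightarrow> b \<in> B \<Longrightarrow> \<sigma> a b t \<in> C"
  shows "hull_bicombing A B t \<subseteq> C"
  unfolding hull_bicombing_def using assms by (intro closed_convex_hull_minimal) auto

lemma hull_bicombing_0:
  assumes "A \<in> CB" "B \<in> CB"
  shows "hull_bicombing A B 0 = A"
proof -
  have "(\<Union>a\<in>A. \<Union>b\<in>B. {\<sigma> a b 0}) = A"
    using CB_D(1,5)[OF assms(1)] CB_D(1,5)[OF assms(2)] start by (auto simp: subset_iff)
  then show ?thesis
    using assms by (simp add: hull_bicombing_def closed_convex_hull_eq CB_D)
qed

lemma hull_bicombing_1:
  assumes "A \<in> CB" "B \<in> CB"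
  shows "hull_bicombing A B 1 = B"
proof -
  have "(\<Union>a\<in>A. \<Union>b\<in>B. {\<sigma> a b 1}) = B"
    using CB_D(1,5)[OF assms(1)] CB_D(1,5)[OF assms(2)] finish by (auto simp: subset_iff)
  then show ?thesis
    using assms by (simp add: hull_bicombing_def closed_convex_hull_eq CB_D)
qed

end

section \<open>Consequences of conicality\<close>

context conical_geodesic_bicombing
begin

lemma bicombing_convex_mcball:
  assumes "p \<in> M"
  shows "bicombing_convex (mcball p r)"
  unfolding bicombing_convex_def
proof (intro conjI ballI)
  fix x y and t :: real
  assume x: "x \<in> mcball p r" and y: "y \<in> mcball p r" and t: "t \<in> {0..1}"
  have "d p (\<sigma> x y t) = d (\<sigma> p p t) (\<sigma> x y t)"
    using assms t by (simp add: bicombing_refl)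
  also have "\<dots> \<le> (1 - t) * d p x + t * d p y"
    using assms x y t by (intro conical) auto
  also have "\<dots> \<le> r"
    using x y t by (intro convex_bound_le) auto
  finally show "\<sigma> x y t \<in> mcball p r"
    using assms x y t maps_to by auto
qed auto

lemma bicombing_convex_closed_nbhd:
  assumes "C \<noteq> {}" "bicombing_convex C"
  shows "bicombing_convex (closed_nbhd e C)"
  unfolding bicombing_convex_def
proof (intro conjI ballI)
  show "closed_nbhd e C \<subseteq> M"
    by (auto simp: closed_nbhd_def)
  fix x y and t :: real
  assume x: "x \<in> closed_nbhd e C" and y: "y \<in> closed_nbhd e C" and t: "t \<in> {0..1}"
  have M: "x \<in> M" "y \<in> M" "C \<subseteq> M"
    using x y assms(2) by (auto simp: closed_nbhd_def bicombing_convex_def)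
  have "\<exists>c\<in>C. d (\<sigma> x y t) c < r" if r: "r > e" for r
  proof -
    obtain u v where uv: "u \<in> C" "d x u < r" "v \<in> C" "d y v < r"
      using x y r assms(1) by (meson in_closed_nbhd_iff)
    have "d (\<sigma> x y t) (\<sigma> u v t) \<le> (1 - t) * d x u + t * d y v"
      using M uv t by (intro conical) auto
    also have "\<dots> < r"
      using uv t by (intro convex_bound_lt) auto
    finally show ?thesis
      using assms(2) uv t by (auto simp: bicombing_convex_def)
  qed
  then show "\<sigma> x y t \<in> closed_nbhd e C"
    using M t assms(1) by (simp add: in_closed_nbhd_iff maps_to)
qed

lemma hull_bicombing_in_CB:
  assumes A: "A \<in> CB" and B: "B \<in> CB" and t: "t \<in> {0..1}"
  shows "hull_bicombing A B t \<in> CB"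
proof -
  have sub: "(\<Union>a\<in>A. \<Union>b\<in>B. {\<sigma> a b t}) \<subseteq> M"
    using CB_D(5)[OF A] CB_D(5)[OF B] t by (auto intro!: maps_to)
  obtain a b where ab: "a \<in> A" "b \<in> B"
    using CB_D(1)[OF A] CB_D(1)[OF B] by blast
  have "mbounded (A \<union> B)"
    using A B by (simp add: mbounded_Un CB_D)
  then obtain p r where ball: "A \<union> B \<subseteq> mcball p r"
    by (auto simp: mbounded_def)
  then have p: "p \<in> M"
    using ab by auto
  have "hull_bicombing A B t \<subseteq> mcball p r"
  proof (rule hull_bicombing_subset)
    fix u v assume "u \<in> A" "v \<in> B"
    with ball t show "\<sigma> u v t \<in> mcball p r"
      using bicombing_convex_mcball[OF p, of r] unfolding bicombing_convex_def by blast
  qed (use p bicombing_convex_mcball closedin_mcball in auto)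
  then have "mbounded (hull_bicombing A B t)"
    using mbounded_def by blast
  moreover have "hull_bicombing A B t \<noteq> {}"
    using hull_bicombing_memI ab by blast
  ultimately show ?thesis
    using closed_convex_hull_closed_convex[OF sub] by (simp add: CB_def hull_bicombing_def)
qed

text \<open>Since closed neighbourhoods of convex sets are themselves closed and convex, an inclusion of
  a hull in such a neighbourhood can be tested on the generators of the hull.\<close>

lemma hull_bicombing_subset_closed_nbhd:
  assumes "C \<in> CB"
    and "\<And>a b. a \<in> A \<Longrightarrow> b \<in> B \<Longrightarrow> \<sigma> a b t \<in> closed_nbhd e C"
  shows "hull_bicombing A B t \<subseteq> closed_nbhd e C"
  by (intro hull_bicombing_subset closedin_closed_nbhd bicombing_convex_closed_nbhd assms
      CB_D[OF assms(1)])

lemma hull_bicombing_subset_conical: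
  assumes A: "A \<in> CB" and B: "B \<in> CB" and A': "A' \<in> CB" and B': "B' \<in> CB" and t: "t \<in> {0..1}"
  shows "hull_bicombing A B t \<subseteq>
    closed_nbhd ((1 - t) * hausdorff_dist A A' + t * hausdorff_dist B B') (hull_bicombing A' B' t)"
    (is "_ \<subseteq> closed_nbhd ?e ?H")
proof (rule hull_bicombing_subset_closed_nbhd)
  show H: "?H \<in> CB"
    using A' B' t by (rule hull_bicombing_in_CB)
  fix a b assume ab: "a \<in> A" "b \<in> B"
  have M: "a \<in> M" "b \<in> M" "A' \<subseteq> M" "B' \<subseteq> M"
    using ab CB_D(5) A B A' B' by auto
  have "\<exists>c\<in>?H. d (\<sigma> a b t) c < r" if r: "r > ?e" for r
  proof -
    define \<delta> where "\<delta> = r - ?e"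
    have \<delta>: "\<delta> > 0"
      using r by (simp add: \<delta>_def)
    obtain a' where a': "a' \<in> A'" "d a a' < hausdorff_dist A A' + \<delta>"
      by (rule CB_near_point[OF A A' ab(1), of "hausdorff_dist A A' + \<delta>"])
        (use \<delta> in auto)
    obtain b' where b': "b' \<in> B'" "d b b' < hausdorff_dist B B' + \<delta>"
      by (rule CB_near_point[OF B B' ab(2), of "hausdorff_dist B B' + \<delta>"])
        (use \<delta> in auto)
    have "d (\<sigma> a b t) (\<sigma> a' b' t) \<le> (1 - t) * d a a' + t * d b b'"
      using M a' b' t by (intro conical) auto
    also have "\<dots> = (1 - t) * (d a a' - hausdorff_dist A A') + t * (d b b' - hausdorff_dist B B') + ?e"
      by (simp add: algebra_simps)
    also have "\<dots> < \<delta> + ?e"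
      using a' b' t by (intro add_strict_right_mono convex_bound_lt) auto
    finally have "d (\<sigma> a b t) (\<sigma> a' b' t) < r"
      by (simp add: \<delta>_def)
    then show ?thesis
      using a' b' hull_bicombing_memI by blast
  qed
  then show "\<sigma> a b t \<in> closed_nbhd ?e ?H"
    using M t CB_D(1)[OF H] by (simp add: in_closed_nbhd_iff maps_to)
qed

lemma hausdorff_dist_hull_bicombing_conical:
  assumes "A \<in> CB" "B \<in> CB" "A' \<in> CB" "B' \<in> CB" "t \<in> {0..1}"
  shows "hausdorff_dist (hull_bicombing A B t) (hull_bicombing A' B' t)
    \<le> (1 - t) * hausdorff_dist A A' + t * hausdorff_dist B B'"
proof -
  have "0 \<le> (1 - t) * hausdorff_dist A A' + t * hausdorff_dist B B'"
    using assms(5) by (simp add: hausdorff_dist_nonneg)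
  moreover have "hull_bicombing A B t \<in> CB" "hull_bicombing A' B' t \<in> CB"
    using assms by (auto intro: hull_bicombing_in_CB)
  ultimately show ?thesis
    using hull_bicombing_subset_conical[of A B A' B' t] hull_bicombing_subset_conical[of A' B' A B t]
      assms
    by (simp add: hausdorff_dist_le_iff CB_D hausdorff_dist_commute)
qed

end

sublocale convex_geodesic_bicombing \<subseteq> conical_geodesic_bicombing
proof
  fix a b a' b' and t :: real
  assume M: "a \<in> M" "b \<in> M" "a' \<in> M" "b' \<in> M" and t: "t \<in> {0..1}"
  have "d (\<sigma> a b ((1 - t) *\<^sub>R 0 + t *\<^sub>R 1)) (\<sigma> a' b' ((1 - t) *\<^sub>R 0 + t *\<^sub>R 1))
      \<le> (1 - t) * d (\<sigma> a b 0) (\<sigma> a' b' 0) + t * d (\<sigma> a b 1) (\<sigma> a' b' 1)"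
    using t by (intro convex_onD[OF convex[OF M]]) auto
  then show "d (\<sigma> a b t) (\<sigma> a' b' t) \<le> (1 - t) * d a a' + t * d b b'"
    using M by (simp add: start finish)
qed

section \<open>Consistency and the geodesic identity\<close>

locale consistent_conical_geodesic_bicombing =
  conical_geodesic_bicombing + consistent_geodesic_bicombing
begin

text \<open>The point \<open>\<sigma>(a,b,s)\<close> divides the geodesic from \<open>a\<close> to \<open>\<sigma>(a,b,t)\<close> in the ratio \<open>u = s/t\<close>;
  moving the endpoint \<open>a\<close> to a point \<open>\<sigma>(a,b',t)\<close> with \<open>b'\<close> close to \<open>a\<close> brings it into the hull
  at time \<open>t\<close>.\<close>

lemma hull_bicombing_subset_later:
  assumes A: "A \<in> CB" and B: "B \<in> CB" and s: "0 \<le> s" and st: "s < t" and t: "t \<le> 1"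
  shows "hull_bicombing A B s \<subseteq>
    closed_nbhd ((t - s) * hausdorff_dist A B) (hull_bicombing A B t)"
    (is "_ \<subseteq> closed_nbhd ?e ?H")
proof (rule hull_bicombing_subset_closed_nbhd)
  show H: "?H \<in> CB"
    using A B s st t by (intro hull_bicombing_in_CB) auto
  fix a b assume ab: "a \<in> A" "b \<in> B"
  have M: "a \<in> M" "b \<in> M" "B \<subseteq> M"
    using ab CB_D(5) A B by auto
  define u where "u = s / t"
  have u: "u \<in> {0..1}" "u * t = s" "(1 - u) * t = t - s"
    using s st by (auto simp: u_def field_simps)
  define y where "y = \<sigma> a b t"
  have y: "y \<in> M" "y \<in> ?H"
    using M s st t ab by (auto simp: y_def maps_to hull_bicombing_memI)
  have x: "\<sigma> a b s = \<sigma> a y u"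
  proof -
    have "\<sigma> (\<sigma> a b 0) (\<sigma> a b t) u = \<sigma> a b ((1 - u) * 0 + u * t)"
      using M s st t u(1) by (intro consistent) auto
    then show ?thesis
      by (simp add: y_def start M u(2))
  qed
  have "\<exists>c\<in>?H. d (\<sigma> a b s) c < r" if r: "r > ?e" for r
  proof -
    have "hausdorff_dist A B < r / (t - s)"
      using r st by (simp add: field_simps)
    then obtain b' where b': "b' \<in> B" "d a b' < r / (t - s)"
      by (rule CB_near_point[OF A B ab(1)])
    define a' where "a' = \<sigma> a b' t"
    have a': "a' \<in> M" "a' \<in> ?H"
      using M b' s st t ab by (auto simp: a'_def maps_to hull_bicombing_memI)
    have "d a a' = t * d a b'"
      using geodesic[of a b' 0 t] M b' s st t by (auto simp: a'_def start)
    moreover have "d (\<sigma> a y u) (\<sigma> a' y u) \<le> (1 - u) * d a a' + u * d y y"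
      using M y a' u by (intro conical) auto
    ultimately have "d (\<sigma> a y u) (\<sigma> a' y u) \<le> (1 - u) * t * d a b'"
      using y by simp
    also have "\<dots> < r"
      using b' st unfolding u(3) by (simp add: field_simps)
    finally show ?thesis
      using CB_D(4)[OF H] a' y u unfolding x bicombing_convex_def by blast
  qed
  then show "\<sigma> a b s \<in> closed_nbhd ?e ?H"
    using M s st t CB_D(1)[OF H] by (simp add: in_closed_nbhd_iff maps_to)
qed

text \<open>Now the endpoint \<open>b\<close> moves: \<open>\<sigma>(a,b,t)\<close> divides the geodesic from \<open>\<sigma>(a,b,s)\<close> to \<open>b\<close> in the
  ratio \<open>u = (t - s)/(1 - s)\<close>. As \<open>\<sigma>(y,x,1 - t)\<close> may differ from \<open>\<sigma>(x,y,t)\<close>, this is not an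
  instance of the previous inclusion with the two sets exchanged.\<close>

lemma hull_bicombing_subset_earlier:
  assumes A: "A \<in> CB" and B: "B \<in> CB" and s: "0 \<le> s" and st: "s < t" and t: "t \<le> 1"
  shows "hull_bicombing A B t \<subseteq>
    closed_nbhd ((t - s) * hausdorff_dist A B) (hull_bicombing A B s)"
    (is "_ \<subseteq> closed_nbhd ?e ?H")
proof (rule hull_bicombing_subset_closed_nbhd)
  show H: "?H \<in> CB"
    using A B s st t by (intro hull_bicombing_in_CB) auto
  fix a b assume ab: "a \<in> A" "b \<in> B"
  have M: "a \<in> M" "b \<in> M" "A \<subseteq> M"
    using ab CB_D(5) A B by auto
  define u where "u = (t - s) / (1 - s)"
  have u: "u \<in> {0..1}" "u * (1 - s) = t - s"
    using st t by (auto simp: u_def field_simps)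
  then have "(1 - u) * s + u * 1 = t"
    by (simp add: algebra_simps)
  define x where "x = \<sigma> a b s"
  have x: "x \<in> M" "x \<in> ?H"
    using M s st t ab by (auto simp: x_def maps_to hull_bicombing_memI)
  have y: "\<sigma> a b t = \<sigma> x b u"
  proof -
    have "\<sigma> (\<sigma> a b s) (\<sigma> a b 1) u = \<sigma> a b ((1 - u) * s + u * 1)"
      using M s st t u(1) by (intro consistent) auto
    then show ?thesis
      unfolding \<open>(1 - u) * s + u * 1 = t\<close> by (simp add: x_def finish M)
  qed
  have "\<exists>c\<in>?H. d (\<sigma> a b t) c < r" if r: "r > ?e" for r
  proof -
    have "hausdorff_dist B A < r / (t - s)"
      using r st by (simp add: field_simps hausdorff_dist_commute)
    then obtain a' where a': "a' \<in> A" "d b a' < r / (t - s)"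
      by (rule CB_near_point[OF B A ab(2)])
    define b' where "b' = \<sigma> a' b s"
    have b': "b' \<in> M" "b' \<in> ?H"
      using M a' s st t ab by (auto simp: b'_def maps_to hull_bicombing_memI)
    have "d b b' = (1 - s) * d b a'"
      using geodesic[of a' b 1 s] M a' s st t by (auto simp: b'_def finish commute)
    moreover have "d (\<sigma> x b u) (\<sigma> x b' u) \<le> (1 - u) * d x x + u * d b b'"
      using M x b' u by (intro conical) auto
    ultimately have "d (\<sigma> x b u) (\<sigma> x b' u) \<le> u * (1 - s) * d b a'"
      using x by simp
    also have "\<dots> < r"
      using a' st by (simp add: u field_simps)
    finally show ?thesis
      using CB_D(4)[OF H] b' x u unfolding y bicombing_convex_def by blast
  qed
  then show "\<sigma> a b t \<in> closed_nbhd ?e ?H"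
    using M s st t CB_D(1)[OF H] by (simp add: in_closed_nbhd_iff maps_to)
qed

lemma hausdorff_dist_hull_bicombing_le:
  assumes "A \<in> CB" "B \<in> CB" "0 \<le> s" "s \<le> t" "t \<le> 1"
  shows "hausdorff_dist (hull_bicombing A B s) (hull_bicombing A B t) \<le> (t - s) * hausdorff_dist A B"
proof (cases "s = t")
  case True
  have "hull_bicombing A B t \<in> CB"
    using assms by (intro hull_bicombing_in_CB) auto
  then have "hausdorff_dist (hull_bicombing A B t) (hull_bicombing A B t) = 0"
    by (simp add: hausdorff_dist_eq_0_iff CB_D)
  then show ?thesis
    by (simp add: True)
next
  case False
  have "hull_bicombing A B s \<in> CB" "hull_bicombing A B t \<in> CB"
    using assms by (auto intro: hull_bicombing_in_CB)
  moreover have "0 \<le> (t - s) * hausdorff_dist A B"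
    using assms by (simp add: hausdorff_dist_nonneg)
  ultimately show ?thesis
    using hull_bicombing_subset_later[of A B s t] hull_bicombing_subset_earlier[of A B s t]
      assms False
    by (simp add: hausdorff_dist_le_iff CB_D)
qed

text \<open>The upper bounds on \<open>[0,s]\<close>, \<open>[s,t]\<close> and \<open>[t,1]\<close> add up to the distance of \<open>A\<close> and \<open>B\<close>, so
  none of them can be strict.\<close>

lemma hausdorff_dist_hull_bicombing:
  assumes A: "A \<in> CB" and B: "B \<in> CB" and "0 \<le> s" "s \<le> t" "t \<le> 1"
  shows "hausdorff_dist (hull_bicombing A B s) (hull_bicombing A B t) = (t - s) * hausdorff_dist A B"
proof (rule antisym)
  interpret H: Metric_space CB hausdorff_dist
    by (rule metric_space_CB)
  let ?S = "hull_bicombing A B"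
  have CB: "?S s \<in> CB" "?S t \<in> CB"
    using assms by (auto intro: hull_bicombing_in_CB)
  have "hausdorff_dist A B \<le> hausdorff_dist A (?S s) + hausdorff_dist (?S s) B"
    using A B CB by (intro H.triangle)
  also have "hausdorff_dist (?S s) B \<le> hausdorff_dist (?S s) (?S t) + hausdorff_dist (?S t) B"
    using B CB by (intro H.triangle)
  also have "hausdorff_dist A (?S s) \<le> s * hausdorff_dist A B"
    using hausdorff_dist_hull_bicombing_le[of A B 0 s] assms by (simp add: hull_bicombing_0)
  also have "hausdorff_dist (?S t) B \<le> (1 - t) * hausdorff_dist A B"
    using hausdorff_dist_hull_bicombing_le[of A B t 1] assms by (simp add: hull_bicombing_1)
  finally show "(t - s) * hausdorff_dist A B \<le> hausdorff_dist (?S s) (?S t)"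
    by (simp add: algebra_simps)
qed (use assms in \<open>rule hausdorff_dist_hull_bicombing_le\<close>)

theorem conical_geodesic_bicombing_hull_bicombing:
  "conical_geodesic_bicombing CB hausdorff_dist hull_bicombing"
proof -
  interpret H: Metric_space CB hausdorff_dist
    by (rule metric_space_CB)
  show ?thesis
  proof
    fix A B and s t :: real
    assume "A \<in> CB" "B \<in> CB" "s \<in> {0..1}" "t \<in> {0..1}"
    then show "hausdorff_dist (hull_bicombing A B s) (hull_bicombing A B t)
        = \<bar>t - s\<bar> * hausdorff_dist A B"
      using hausdorff_dist_hull_bicombing[of A B s t] hausdorff_dist_hull_bicombing[of A B t s]
      by (cases "s \<le> t") (simp_all add: hausdorff_dist_commute)
  qed (auto simp: hull_bicombing_0 hull_bicombing_1
      intro: hull_bicombing_in_CB hausdorff_dist_hull_bicombing_conical)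
qed

end

theorem theorem3p4:
  fixes M :: "'a set"
    and d :: "'a \<Rightarrow> 'a \<Rightarrow> real"
    and \<sigma> :: "'a \<Rightarrow> 'a \<Rightarrow> real \<Rightarrow> 'a"
  assumes "Metric_space M d"
    and "convex_geodesic_bicombing M d \<sigma>"
    and "consistent_geodesic_bicombing M d \<sigma>"
  shows "conical_geodesic_bicombing
    (geodesic_bicombing.CB M d \<sigma>)
    (Metric_space.hausdorff_dist M d)
    (\<lambda>A B t. geodesic_bicombing.closed_convex_hull M d \<sigma>
      (\<Union>a\<in>A. \<Union>b\<in>B. {\<sigma> a b t}))"
proof -
  interpret convex_geodesic_bicombing M d \<sigma>
    by (rule assms(2))
  interpret consistent_geodesic_bicombing M d \<sigma>
    by (rule assms(3))
  interpret consistent_conical_geodesic_bicombing M d \<sigma> ..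
  show ?thesis
    using conical_geodesic_bicombing_hull_bicombing unfolding hull_bicombing_def[abs_def] .
qed

end
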